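(* Let $G$ be a $k$-chromatic graph of order $n$ and size $m$. Then every root $z\in\mathbb{C}$ of $\pi(G,z)$ lies in $\{0,1,\dots,k-1\}\cup\mathcal{U}$, where $\mathcal{U}$ is the union of the closed discs in $\mathbb{C}$ centered at $$k,\ k+1,\ \dots,\ n-2,\ n-1-\binom{n}{2}+m,$$ each of radius $\sqrt{2}\left(\binom{n}{2}-m\right)$. Consequently, the modulus of every chromatic root of a graph of order $n$ with $m$ edges is at most $n-1+\sqrt{2}\left(\binom{n}{2}-m\right)$.
   Context: All graphs are finite and simple. $\pi(G,z)$ denotes the chromatic polynomial of $G$, and a chromatic root is a (complex) root of a chromatic polynomial. A graph is $k$-chromatic if its chromatic number is $k$. *)

theory Defs
  imports "HOL-Analysis.Analysis" "HOL-Computational_Algebra.Polynomial"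
begin

definition simple_graph :: "'a set \<Rightarrow> 'a set set \<Rightarrow> bool" where
  "simple_graph V E \<longleftrightarrow> finite V \<and> (\<forall>e\<in>E. e \<subseteq> V \<and> card e = 2)"

text \<open>
  Using the extensional function space makes two colourings equal exactly when they agree
  on \<^term>\<open>V\<close>, so that the cardinality of this set is the number of proper \<^term>\<open>q\<close>-colourings.
\<close>

definition proper_colorings :: "'a set \<Rightarrow> 'a set set \<Rightarrow> nat \<Rightarrow> ('a \<Rightarrow> nat) set" where
  "proper_colorings V E q =
     {f \<in> V \<rightarrow>\<^sub>E {..<q}. \<forall>u v. {u, v} \<in> E \<longrightarrow> f u \<noteq> f v}"

definition chromatic_number :: "'a set \<Rightarrow> 'a set set \<Rightarrow> nat" where
  "chromatic_number V E = (LEAST q. proper_colorings V E q \<noteq> {})"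

definition chromatic_poly :: "'a set \<Rightarrow> 'a set set \<Rightarrow> complex poly" where
  "chromatic_poly V E =
     (THE p. \<forall>q. poly p (of_nat q) = of_nat (card (proper_colorings V E q)))"

text \<open>
  The remaining facts show that the definite description above denotes, and that the chromatic
  number is attained. Existence of the polynomial comes from sorting the colourings by the set
  of colours they use.
\<close>

definition onto_colorings :: "'a set \<Rightarrow> 'a set set \<Rightarrow> nat set \<Rightarrow> ('a \<Rightarrow> nat) set" where
  "onto_colorings V E S =
     {f \<in> V \<rightarrow>\<^sub>E S. f ` V = S \<and> (\<forall>u v. {u, v} \<in> E \<longrightarrow> f u \<noteq> f v)}"

lemma simple_graph_edgeD:
  assumes "simple_graph V E" "{u, v} \<in> E"
  shows "u \<in> V" "v \<in> V" "u \<noteq> v"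
  using assms by (auto simp: simple_graph_def)

lemma card_onto_colorings_le:
  assumes G: "simple_graph V E" and h: "bij_betw h S T" and fin: "finite T"
  shows "card (onto_colorings V E S) \<le> card (onto_colorings V E T)"
proof (rule card_inj_on_le[where f = "\<lambda>f. restrict (h \<circ> f) V"])
  have inj: "inj_on h S" and img: "h ` S = T"
    using h by (auto simp: bij_betw_def)
  show "inj_on (\<lambda>f. restrict (h \<circ> f) V) (onto_colorings V E S)"
  proof (rule inj_onI)
    fix f g assume f: "f \<in> onto_colorings V E S" and g: "g \<in> onto_colorings V E S"
      and eq: "restrict (h \<circ> f) V = restrict (h \<circ> g) V"
    show "f = g"
    proof (rule PiE_ext)
      show "f \<in> V \<rightarrow>\<^sub>E S" "g \<in> V \<rightarrow>\<^sub>E S"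
        using f g by (auto simp: onto_colorings_def)
      fix x assume x: "x \<in> V"
      have "h (f x) = h (g x)" using fun_cong[OF eq, of x] x by simp
      moreover have "f x \<in> S" "g x \<in> S" using f g x by (auto simp: onto_colorings_def)
      ultimately show "f x = g x" using inj by (auto dest: inj_onD)
    qed
  qed
  show "(\<lambda>f. restrict (h \<circ> f) V) ` onto_colorings V E S \<subseteq> onto_colorings V E T"
  proof clarify
    fix f assume f: "f \<in> onto_colorings V E S"
    have fS: "f x \<in> S" if "x \<in> V" for x using f that by (auto simp: onto_colorings_def)
    have fV: "f ` V = S" using f by (auto simp: onto_colorings_def)
    have "restrict (h \<circ> f) V \<in> V \<rightarrow>\<^sub>E T" using fS img by fastforce
    moreover have "restrict (h \<circ> f) V ` V = T"
      using fV img by (auto simp: image_comp[symmetric])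
    moreover have "restrict (h \<circ> f) V u \<noteq> restrict (h \<circ> f) V v" if "{u, v} \<in> E" for u v
    proof -
      have uv: "u \<in> V" "v \<in> V" using simple_graph_edgeD[OF G that] by auto
      have "f u \<noteq> f v" using f that by (auto simp: onto_colorings_def)
      then show ?thesis using uv fS inj by (auto dest: inj_onD)
    qed
    ultimately show "restrict (h \<circ> f) V \<in> onto_colorings V E T"
      by (auto simp: onto_colorings_def)
  qed
  have "finite (V \<rightarrow>\<^sub>E T)"
    using G fin by (intro finite_PiE) (auto simp: simple_graph_def)
  then show "finite (onto_colorings V E T)"
    by (rule rev_finite_subset) (auto simp: onto_colorings_def)
qed

lemma card_onto_colorings:
  assumes G: "simple_graph V E" and fin: "finite S"
  shows "card (onto_colorings V E S) = card (onto_colorings V E {..<card S})"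
proof -
  obtain h where h: "bij_betw h S {..<card S}"
    using ex_bij_betw_finite_nat[OF fin] by (auto simp: atLeast0LessThan)
  show ?thesis
    using card_onto_colorings_le[OF G h] card_onto_colorings_le[OF G bij_betw_inv_into[OF h] fin]
    by simp
qed

lemma card_proper_colorings:
  assumes G: "simple_graph V E"
  shows "card (proper_colorings V E q) =
    (\<Sum>i\<le>card V. (q choose i) * card (onto_colorings V E {..<i}))"
proof -
  have finV: "finite V" using G by (simp add: simple_graph_def)
  have fin_on: "finite (onto_colorings V E S)" if "finite S" for S
  proof -
    have "finite (V \<rightarrow>\<^sub>E S)" using finV that by (intro finite_PiE) auto
    then show ?thesis by (rule rev_finite_subset) (auto simp: onto_colorings_def)
  qed
  let ?A = "{S. S \<subseteq> {..<q} \<and> card S \<le> card V}"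
  have finA: "finite ?A" by (rule finite_subset[of _ "Pow {..<q}"]) auto
  have "proper_colorings V E q = (\<Union>S\<in>?A. onto_colorings V E S)"
  proof (intro set_eqI iffI)
    fix f assume f: "f \<in> proper_colorings V E q"
    have "f ` V \<in> ?A" using f card_image_le[OF finV]
      by (auto simp: proper_colorings_def)
    moreover have "f \<in> onto_colorings V E (f ` V)" using f
      by (auto simp: proper_colorings_def onto_colorings_def PiE_def)
    ultimately show "f \<in> (\<Union>S\<in>?A. onto_colorings V E S)" by blast
  next
    fix f assume "f \<in> (\<Union>S\<in>?A. onto_colorings V E S)"
    then show "f \<in> proper_colorings V E q"
      by (fastforce simp: proper_colorings_def onto_colorings_def PiE_def)
  qed
  also have "card \<dots> = (\<Sum>S\<in>?A. card (onto_colorings V E S))"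
  proof (rule card_UN_disjoint[OF finA])
    show "\<forall>S\<in>?A. finite (onto_colorings V E S)"
      using fin_on finite_subset by blast
    show "\<forall>S\<in>?A. \<forall>T\<in>?A. S \<noteq> T \<longrightarrow> onto_colorings V E S \<inter> onto_colorings V E T = {}"
      by (auto simp: onto_colorings_def)
  qed
  also have "\<dots> = (\<Sum>S\<in>?A. card (onto_colorings V E {..<card S}))"
    by (intro sum.cong refl card_onto_colorings[OF G]) (auto intro: finite_subset)
  also have "\<dots> = (\<Sum>i\<le>card V. \<Sum>S | S \<in> ?A \<and> card S = i.
                     card (onto_colorings V E {..<card S}))"
    by (rule sum.group[symmetric]) (use finA in auto)
  also have "\<dots> = (\<Sum>i\<le>card V. (q choose i) * card (onto_colorings V E {..<i}))"
  proof (rule sum.cong[OF refl])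
    fix i assume i: "i \<in> {..card V}"
    have "{S. S \<in> ?A \<and> card S = i} = {S. S \<subseteq> {..<q} \<and> card S = i}" using i by auto
    then show "(\<Sum>S | S \<in> ?A \<and> card S = i. card (onto_colorings V E {..<card S}))
        = (q choose i) * card (onto_colorings V E {..<i})"
      using n_subsets[of "{..<q}" i] by simp
  qed
  finally show ?thesis .
qed

lemma poly_eqI_of_nat:
  fixes p r :: "complex poly"
  assumes "\<And>q. poly p (of_nat q) = poly r (of_nat q)"
  shows "p = r"
proof (rule ccontr)
  assume "p \<noteq> r"
  then have "finite {x. poly (p - r) x = 0}" by (intro poly_roots_finite) simp
  moreover have "range of_nat \<subseteq> {x. poly (p - r) x = 0}" using assms by auto
  ultimately have "finite (range (of_nat :: nat \<Rightarrow> complex))" by (rule rev_finite_subset)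
  then have "finite (UNIV :: nat set)" by (rule finite_imageD[OF _ inj_of_nat])
  then show False by simp
qed

lemma chromatic_poly_ex1:
  assumes G: "simple_graph V E"
  shows "\<exists>!p :: complex poly. \<forall>q. poly p (of_nat q) = of_nat (card (proper_colorings V E q))"
proof (rule ex_ex1I)
  let ?c = "\<lambda>i. card (onto_colorings V E {..<i})"
  let ?p = "\<Sum>i\<le>card V. smult (of_nat (?c i) / fact i) (\<Prod>j<i. [:- of_nat j, 1 :: complex:])"
  have "poly ?p (of_nat q) = of_nat (card (proper_colorings V E q))" for q
  proof -
    have "of_nat (?c i) / fact i * (\<Prod>j<i. poly [:- of_nat j, 1:] (of_nat q))
        = (of_nat ((q choose i) * ?c i) :: complex)" for i
    proof -
      have "(of_nat (q choose i) :: complex) = (\<Prod>j<i. of_nat q - of_nat j) / fact i"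
        by (simp only: binomial_gbinomial gbinomial_prod_rev atLeast0LessThan)
      then show ?thesis by simp
    qed
    then show ?thesis
      unfolding card_proper_colorings[OF G] of_nat_sum poly_sum poly_smult poly_prod by simp
  qed
  then show "\<exists>p :: complex poly. \<forall>q. poly p (of_nat q) = of_nat (card (proper_colorings V E q))"
    by blast
next
  fix p r :: "complex poly"
  assume "\<forall>q. poly p (of_nat q) = of_nat (card (proper_colorings V E q))"
    and "\<forall>q. poly r (of_nat q) = of_nat (card (proper_colorings V E q))"
  then show "p = r" by (intro poly_eqI_of_nat) simp
qed

lemma poly_chromatic_poly_of_nat:
  assumes "simple_graph V E"
  shows "poly (chromatic_poly V E) (of_nat q) = of_nat (card (proper_colorings V E q))"
  unfolding chromatic_poly_def using theI'[OF chromatic_poly_ex1[OF assms]] by (rule spec)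

lemma proper_colorings_chromatic_number:
  assumes G: "simple_graph V E"
  shows "proper_colorings V E (chromatic_number V E) \<noteq> {}"
proof -
  have "finite V" using G by (simp add: simple_graph_def)
  then obtain h where h: "bij_betw h V {..<card V}"
    using ex_bij_betw_finite_nat by (auto simp: atLeast0LessThan)
  then have inj: "inj_on h V" and img: "h ` V = {..<card V}" by (simp_all add: bij_betw_def)
  have "restrict h V u \<noteq> restrict h V v" if "{u, v} \<in> E" for u v
    using simple_graph_edgeD[OF G that] inj by (simp add: inj_on_eq_iff)
  moreover have "restrict h V \<in> V \<rightarrow>\<^sub>E {..<card V}"
    unfolding img [symmetric] by (rule restrict_PiE_iff[THEN iffD2]) blast
  ultimately have "proper_colorings V E (card V) \<noteq> {}"
    unfolding proper_colorings_def by blast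
  then show ?thesis
    unfolding chromatic_number_def by (rule LeastI)
qed

end

theory Submission
  imports Defs
begin

text \<open>
  Expand the chromatic polynomial in falling factorials: the coefficient of the factorial of degree
  \<open>j\<close> is the number \<open>a j\<close> of partitions of the vertex set into \<open>j\<close> independent sets. With
  \<open>e\<close> the number of non-edges, \<open>a n = 1\<close>, \<open>a (n - 1) = e\<close>, and \<open>a (n - i) \<le> e choose i\<close>,
  as deleting a vertex with \<open>d\<close> non-neighbours shows. Divide \<open>\<pi>(G,z) = 0\<close> by the falling factorial
  of degree \<open>n - 1\<close>. If \<open>z\<close> has distance more than \<open>sqrt 2 * e\<close> from \<open>k, ..., n - 2\<close>, then
  \<open>z - (n - 1) + e = - (\<Sum>i=2..n. t i)\<close>, where \<open>t i\<close> has modulus at most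
  \<open>(e choose i) / (sqrt 2 * e) ^ (i - 1)\<close>; these bounds add up to less than \<open>e / 2\<close>.
  The modulus bound does not follow from the discs, since the last centre may lie far to the left of
  \<open>0\<close>. It uses in addition that \<open>t 2\<close> is a nonnegative real divided by \<open>z - (n - 2)\<close>.
\<close>

section \<open>Surjective colourings under deletion of a vertex\<close>

lemma finite_onto_colorings:
  assumes "finite V" "finite S"
  shows "finite (onto_colorings V E S)"
proof -
  have "finite (V \<rightarrow>\<^sub>E S)" using assms by (intro finite_PiE) auto
  then show ?thesis by (rule rev_finite_subset) (auto simp: onto_colorings_def)
qed

text \<open>If \<open>v\<close> alone carries its colour \<open>c\<close>, the edges at
  \<open>v\<close> impose nothing, and the rest is an arbitrary proper colouring of \<open>V\<close>
  onto the remaining colours.\<close>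

lemma onto_colorings_new_color:
  assumes G: "simple_graph (insert v V) E" and v: "v \<notin> V"
  shows "{f \<in> onto_colorings (insert v V) E S. f v \<notin> f ` V} =
    (\<lambda>(c, g). g(v := c)) ` (SIGMA c:S. onto_colorings V {e \<in> E. v \<notin> e} (S - {c}))"
    (is "?L = ?h ` ?R")
proof (intro set_eqI iffI)
  fix f assume "f \<in> ?L"
  then have f: "f \<in> insert v V \<rightarrow>\<^sub>E S" "f ` insert v V = S" "f v \<notin> f ` V"
    and E: "\<And>x y. {x, y} \<in> E \<Longrightarrow> f x \<noteq> f y"
    by (auto simp: onto_colorings_def)
  have ne: "f i \<noteq> f v" if "i \<in> V" for i using imageI[OF that, of f] f(3) by metis
  have img: "(f(v := undefined)) ` V = f ` V"
    using v by (intro image_cong) auto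
  \<comment> \<open>Resetting \<open>v\<close> to \<open>undefined\<close> restricts
    \<open>f\<close> to \<open>V\<close> among extensional functions.\<close>
  have "f(v := undefined) \<in> onto_colorings V {e \<in> E. v \<notin> e} (S - {f v})"
    unfolding onto_colorings_def
  proof (intro CollectI conjI allI impI)
    show "(f(v := undefined)) \<in> V \<rightarrow>\<^sub>E S - {f v}"
      using f(1) ne v by (auto simp: PiE_iff extensional_def)
    show "(f(v := undefined)) ` V = S - {f v}"
      unfolding img using f(2,3) by blast
    fix x y assume "{x, y} \<in> {e \<in> E. v \<notin> e}"
    then show "(f(v := undefined)) x \<noteq> (f(v := undefined)) y" using E by auto
  qed
  moreover have "f = ?h (f v, f(v := undefined))" by auto
  moreover have "f v \<in> S" using f by auto
  ultimately show "f \<in> ?h ` ?R" by blast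
next
  fix f assume "f \<in> ?h ` ?R"
  then obtain c g where c: "c \<in> S" and fg: "f = g(v := c)"
    and g: "g \<in> V \<rightarrow>\<^sub>E S - {c}" "g ` V = S - {c}"
    and E: "\<And>x y. {x, y} \<in> E \<Longrightarrow> v \<notin> {x, y} \<Longrightarrow> g x \<noteq> g y"
    by (auto simp: onto_colorings_def)
  have img: "f ` V = g ` V" unfolding fg using v by (intro image_cong) auto
  have "f x \<noteq> f y" if xy: "{x, y} \<in> E" for x y
  proof -
    have "x \<in> insert v V" "y \<in> insert v V" "x \<noteq> y" using simple_graph_edgeD[OF G xy] by auto
    moreover have "g w \<noteq> c" if "w \<in> V" for w using g that by auto
    ultimately show ?thesis using E[OF xy] unfolding fg by (cases "x = v"; cases "y = v") auto
  qed
  moreover have "f \<in> insert v V \<rightarrow>\<^sub>E S"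
    unfolding fg using g c by (auto simp: PiE_iff extensional_def)
  moreover have "f ` insert v V = S" using img g c unfolding fg by auto
  moreover have "f v \<notin> f ` V" using img g unfolding fg by auto
  ultimately show "f \<in> ?L" by (auto simp: onto_colorings_def)
qed

text \<open>If \<open>v\<close> shares its colour, the rest still uses all of \<open>S\<close>, and
  the colour of \<open>v\<close> may be any colour absent from its neighbours.\<close>

lemma onto_colorings_old_color:
  assumes G: "simple_graph (insert v V) E" and v: "v \<notin> V"
  shows "{f \<in> onto_colorings (insert v V) E S. f v \<in> f ` V} =
    (\<lambda>(g, c). g(v := c)) `
      (SIGMA g:onto_colorings V {e \<in> E. v \<notin> e} S. S - g ` {u. {u, v} \<in> E})"
    (is "?L = ?h ` ?R")
proof (intro set_eqI iffI)
  fix f assume "f \<in> ?L"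
  then have f: "f \<in> insert v V \<rightarrow>\<^sub>E S" "f ` insert v V = S" "f v \<in> f ` V"
    and E: "\<And>x y. {x, y} \<in> E \<Longrightarrow> f x \<noteq> f y"
    by (auto simp: onto_colorings_def)
  have img: "(f(v := undefined)) ` V = f ` V"
    using v by (intro image_cong) auto
  have "f(v := undefined) \<in> onto_colorings V {e \<in> E. v \<notin> e} S"
    unfolding onto_colorings_def
  proof (intro CollectI conjI allI impI)
    show "(f(v := undefined)) \<in> V \<rightarrow>\<^sub>E S"
      using f(1) v by (auto simp: PiE_iff extensional_def)
    show "(f(v := undefined)) ` V = S"
      unfolding img using f(2,3) by auto
    fix x y assume "{x, y} \<in> {e \<in> E. v \<notin> e}"
    then show "(f(v := undefined)) x \<noteq> (f(v := undefined)) y" using E by auto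
  qed
  moreover have "f v \<notin> (f(v := undefined)) ` {u. {u, v} \<in> E}"
  proof
    assume "f v \<in> (f(v := undefined)) ` {u. {u, v} \<in> E}"
    then obtain u where u: "{u, v} \<in> E" "f v = (f(v := undefined)) u" by blast
    then show False using E[OF u(1)] simple_graph_edgeD(3)[OF G u(1)] by simp
  qed
  moreover have "f = ?h (f(v := undefined), f v)" by auto
  moreover have "f v \<in> S" using f by auto
  ultimately show "f \<in> ?h ` ?R" by blast
next
  fix f assume "f \<in> ?h ` ?R"
  then obtain p where p: "p \<in> ?R" "f = ?h p" by blast
  obtain g c where gc: "p = (g, c)" by (cases p)
  have c: "c \<in> S" "\<And>u. {u, v} \<in> E \<Longrightarrow> g u \<noteq> c" and fg: "f = g(v := c)"
    and g: "g \<in> V \<rightarrow>\<^sub>E S" "g ` V = S"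
    and E: "\<And>x y. {x, y} \<in> E \<Longrightarrow> v \<notin> {x, y} \<Longrightarrow> g x \<noteq> g y"
    using p unfolding gc by (force simp: onto_colorings_def)+
  have img: "f ` V = g ` V" unfolding fg using v by (intro image_cong) auto
  have "f x \<noteq> f y" if xy: "{x, y} \<in> E" for x y
  proof -
    have "x \<noteq> y" using simple_graph_edgeD[OF G xy] by auto
    moreover have "{y, x} \<in> E" using xy by (simp add: insert_commute)
    ultimately show ?thesis using E[OF xy] xy c(2)[of x] c(2)[of y] unfolding fg
      by (cases "x = v"; cases "y = v") auto
  qed
  moreover have "f \<in> insert v V \<rightarrow>\<^sub>E S"
    unfolding fg using g c by (auto simp: PiE_iff extensional_def)
  moreover have "f ` insert v V = S" using img g c unfolding fg by auto
  moreover have "f v \<in> f ` V" using img g c unfolding fg by auto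
  ultimately show "f \<in> ?L" by (auto simp: onto_colorings_def)
qed

lemma simple_graph_delete_vertex:
  assumes "simple_graph (insert v V) E"
  shows "simple_graph V {e \<in> E. v \<notin> e}"
  using assms by (auto simp: simple_graph_def)

lemma card_onto_colorings_insert:
  assumes G: "simple_graph (insert v V) E" and v: "v \<notin> V"
  shows "card (onto_colorings (insert v V) E {..<j}) =
    j * card (onto_colorings V {e \<in> E. v \<notin> e} {..<j - 1}) +
    (\<Sum>g \<in> onto_colorings V {e \<in> E. v \<notin> e} {..<j}. card ({..<j} - g ` {u. {u, v} \<in> E}))"
proof -
  let ?E = "{e \<in> E. v \<notin> e}" and ?N = "{u. {u, v} \<in> E}"
  let ?O = "onto_colorings (insert v V) E {..<j}"
  have fin: "finite V" using G by (simp add: simple_graph_def)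
  note G' = simple_graph_delete_vertex[OF G]
  have und: "g v = undefined" if "g \<in> onto_colorings V ?E S" for g S
    using that v by (auto simp: onto_colorings_def PiE_iff extensional_def)
  \<comment> \<open>A colouring of \<open>V\<close> is \<open>undefined\<close> at \<open>v\<close>,
    so \<open>g(v := c)\<close> determines both \<open>g\<close> and \<open>c\<close>; this makes
    the two parametrisations injective.\<close>
  have upd: "g = g' \<and> c = c'"
    if "g(v := c) = g'(v := c')" "g v = undefined" "g' v = undefined" for g g' :: "'a \<Rightarrow> nat" and c c'
  proof
    have "(g(v := c))(v := undefined) = (g'(v := c'))(v := undefined)" using that(1) by simp
    then show "g = g'" using that(2,3) by (simp add: fun_upd_idem)
    show "c = c'" using fun_cong[OF that(1), of v] by simp
  qed
  have "?O = {f \<in> ?O. f v \<notin> f ` V} \<union> {f \<in> ?O. f v \<in> f ` V}" by auto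
  also have "card \<dots> = card {f \<in> ?O. f v \<notin> f ` V} + card {f \<in> ?O. f v \<in> f ` V}"
  proof (rule card_Un_disjoint)
    have "finite ?O" using fin by (intro finite_onto_colorings) auto
    then show "finite {f \<in> ?O. f v \<notin> f ` V}" "finite {f \<in> ?O. f v \<in> f ` V}" by simp_all
  qed auto
  also have "card {f \<in> ?O. f v \<notin> f ` V} = card (SIGMA c:{..<j}. onto_colorings V ?E ({..<j} - {c}))"
    unfolding onto_colorings_new_color[OF G v]
    by (rule card_image, rule inj_onI, clarsimp) (metis upd und)
  also have "\<dots> = (\<Sum>c<j. card (onto_colorings V ?E ({..<j} - {c})))"
    using fin by (intro card_SigmaI) (auto intro: finite_onto_colorings)
  \<comment> \<open>Only the size of the colour set matters, so \<open>{..<j} - {c}\<close> can be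
    replaced by \<open>{..<j - 1}\<close>.\<close>
  also have "\<dots> = (\<Sum>c<j. card (onto_colorings V ?E {..<j - 1}))"
  proof (rule sum.cong[OF refl])
    fix c assume "c \<in> {..<j}"
    then show "card (onto_colorings V ?E ({..<j} - {c})) = card (onto_colorings V ?E {..<j - 1})"
      by (subst card_onto_colorings[OF G']) auto
  qed
  also have "card {f \<in> ?O. f v \<in> f ` V} =
      card (SIGMA g:onto_colorings V ?E {..<j}. {..<j} - g ` ?N)"
    unfolding onto_colorings_old_color[OF G v]
    by (rule card_image, rule inj_onI, clarsimp) (metis upd und)
  also have "\<dots> = (\<Sum>g \<in> onto_colorings V ?E {..<j}. card ({..<j} - g ` ?N))"
    using fin by (intro card_SigmaI) (auto intro: finite_onto_colorings)
  finally show ?thesis by simp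
qed


section \<open>Edge counts and deletion of a vertex\<close>

lemma card_edges_le:
  assumes "simple_graph V E"
  shows "card E \<le> card V choose 2"
proof -
  have fin: "finite V" and "E \<subseteq> {e. e \<subseteq> V \<and> card e = 2}"
    using assms by (auto simp: simple_graph_def)
  then have "card E \<le> card {e. e \<subseteq> V \<and> card e = 2}"
    by (intro card_mono) auto
  then show ?thesis by (simp add: n_subsets[OF fin])
qed

text \<open>The edges at \<open>v\<close> correspond to its neighbours. Deleting a vertex with
  \<open>d\<close> non-neighbours therefore lowers the number of non-edges by exactly
  \<open>d\<close>.\<close>

lemma card_edges_delete_vertex:
  assumes G: "simple_graph (insert v V) E"
  shows "card E = card {e \<in> E. v \<notin> e} + card {u. {u, v} \<in> E}"
proof -
  let ?N = "{u. {u, v} \<in> E}"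
  have ne: "u \<noteq> v" if "{u, v} \<in> E" for u using simple_graph_edgeD(3)[OF G that] .
  have fin: "finite E"
    using G finite_subset[of E "Pow (insert v V)"] by (auto simp: simple_graph_def)
  have "E = {e \<in> E. v \<notin> e} \<union> (\<lambda>u. {u, v}) ` ?N"
  proof (intro set_eqI iffI)
    fix e assume e: "e \<in> E"
    then have "card e = 2" using G by (auto simp: simple_graph_def)
    then obtain x y where "e = {x, y}" by (auto simp: card_2_iff)
    with e show "e \<in> {e \<in> E. v \<notin> e} \<union> (\<lambda>u. {u, v}) ` ?N"
      by (cases "v = x"; cases "v = y") (auto simp: insert_commute)
  qed auto
  moreover have "finite ((\<lambda>u. {u, v}) ` ?N)"
    using fin by (rule rev_finite_subset) auto
  moreover have "{e \<in> E. v \<notin> e} \<inter> (\<lambda>u. {u, v}) ` ?N = {}" by auto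
  ultimately have "card E = card {e \<in> E. v \<notin> e} + card ((\<lambda>u. {u, v}) ` ?N)"
    using fin card_Un_disjoint[of "{e \<in> E. v \<notin> e}" "(\<lambda>u. {u, v}) ` ?N"] by simp
  also have "card ((\<lambda>u. {u, v}) ` ?N) = card ?N"
    by (rule card_image) (auto simp: inj_on_def doubleton_eq_iff dest: ne)
  finally show ?thesis .
qed

section \<open>Partitions into independent blocks\<close>

text \<open>
  Onto colourings with \<^term>\<open>j\<close> colours come from partitions of \<^term>\<open>V\<close> into
  \<^term>\<open>j\<close> independent blocks, each partition giving \<^term>\<open>fact j\<close> of them.
\<close>

definition stable_partitions :: "'a set \<Rightarrow> 'a set set \<Rightarrow> nat \<Rightarrow> real" where
  "stable_partitions V E j = real (card (onto_colorings V E {..<j})) / fact j"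

lemma stable_partitions_nonneg: "stable_partitions V E j \<ge> 0"
  by (simp add: stable_partitions_def)

lemma stable_partitions_eq_0_card:
  assumes "finite V" "card V < j"
  shows "stable_partitions V E j = 0"
proof -
  have "f ` V \<noteq> {..<j}" for f :: "'a \<Rightarrow> nat"
    using card_image_le[OF assms(1), of f] assms(2) by auto
  then have "onto_colorings V E {..<j} = {}" by (auto simp: onto_colorings_def)
  then show ?thesis by (simp add: stable_partitions_def)
qed

text \<open>A surjective colouring with \<open>j\<close> colours is in particular a proper
  \<open>j\<close>-colouring. This is how the chromatic number enters: falling factorials of smaller
  degree drop out of the expansion.\<close>

lemma stable_partitions_eq_0_chromatic_number:
  assumes "j < chromatic_number V E"
  shows "stable_partitions V E j = 0"
proof -
  have "proper_colorings V E j = {}"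
    using not_less_Least assms unfolding chromatic_number_def by blast
  moreover have "onto_colorings V E {..<j} \<subseteq> proper_colorings V E j"
    by (auto simp: onto_colorings_def proper_colorings_def)
  ultimately show ?thesis by (simp add: stable_partitions_def)
qed

lemma stable_partitions_insert_0: "stable_partitions (insert v V) E 0 = 0"
proof -
  have "onto_colorings (insert v V) E {..<0} = {}" by (auto simp: onto_colorings_def)
  then show ?thesis by (simp add: stable_partitions_def)
qed

text \<open>In a partition, \<open>v\<close> is a block of its own or joins a block without
  neighbours. The sum counts the second case with labelled blocks.\<close>

lemma stable_partitions_insert_Suc:
  assumes G: "simple_graph (insert v V) E" and v: "v \<notin> V"
  shows "stable_partitions (insert v V) E (Suc j) =
    stable_partitions V {e \<in> E. v \<notin> e} j +
    (\<Sum>g \<in> onto_colorings V {e \<in> E. v \<notin> e} {..<Suc j}.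
      real (card ({..<Suc j} - g ` {u. {u, v} \<in> E}))) / fact (Suc j)"
proof -
  have *: "real (Suc j * a + b) / fact (Suc j) = a / fact j + b / fact (Suc j)" for a b :: nat
    unfolding of_nat_add of_nat_mult add_divide_distrib fact_Suc
    by (simp del: of_nat_Suc)
  show ?thesis
    unfolding stable_partitions_def card_onto_colorings_insert[OF G v] of_nat_sum[symmetric]
    by (simp only: * diff_Suc_1)
qed

text \<open>By surjectivity, every colour missing from \<open>N\<close> is the colour of a vertex
  outside \<open>N\<close>.\<close>

lemma card_free_colors_le:
  assumes "finite V" "N \<subseteq> V" "g \<in> onto_colorings V E S"
  shows "card (S - g ` N) \<le> card V - card N"
proof -
  have "S - g ` N \<subseteq> g ` (V - N)" using assms(3) by (auto simp: onto_colorings_def)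
  then have "card (S - g ` N) \<le> card (g ` (V - N))"
    using assms(1) by (intro card_mono) auto
  also have "\<dots> \<le> card (V - N)" using assms(1) by (intro card_image_le) auto
  also have "\<dots> = card V - card N"
    using assms(1,2) by (intro card_Diff_subset) (auto intro: finite_subset)
  finally show ?thesis .
qed

lemma stable_partitions_insert_Suc_le:
  assumes G: "simple_graph (insert v V) E" and v: "v \<notin> V"
  shows "stable_partitions (insert v V) E (Suc j) \<le>
    stable_partitions V {e \<in> E. v \<notin> e} j +
    real (card V - card {u. {u, v} \<in> E}) * stable_partitions V {e \<in> E. v \<notin> e} (Suc j)"
proof -
  let ?O = "onto_colorings V {e \<in> E. v \<notin> e} {..<Suc j}" and ?N = "{u. {u, v} \<in> E}"
  have "?N \<subseteq> V" using simple_graph_edgeD[OF G] by blast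
  moreover have "finite V" using G by (simp add: simple_graph_def)
  ultimately have "(\<Sum>g\<in>?O. real (card ({..<Suc j} - g ` ?N))) \<le> (\<Sum>g\<in>?O. real (card V - card ?N))"
    by (intro sum_mono of_nat_mono card_free_colors_le)
  then have "(\<Sum>g\<in>?O. real (card ({..<Suc j} - g ` ?N))) / fact (Suc j) \<le>
      (\<Sum>g\<in>?O. real (card V - card ?N)) / fact (Suc j)"
    by (intro divide_right_mono) auto
  then show ?thesis
    unfolding stable_partitions_insert_Suc[OF G v] by (simp add: stable_partitions_def mult.commute)
qed

text \<open>With as many colours as vertices each \<open>g\<close> is a bijection, so distinct
  non-neighbours give distinct free colours and the general upper bound becomes an equality.\<close>

lemma stable_partitions_insert_card:
  assumes G: "simple_graph (insert v V) E" and v: "v \<notin> V" and j: "card V = Suc j"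
  shows "stable_partitions (insert v V) E (card V) =
    stable_partitions V {e \<in> E. v \<notin> e} j +
    real (card V - card {u. {u, v} \<in> E}) * stable_partitions V {e \<in> E. v \<notin> e} (card V)"
proof -
  let ?O = "onto_colorings V {e \<in> E. v \<notin> e} {..<card V}" and ?N = "{u. {u, v} \<in> E}"
  have N: "?N \<subseteq> V" using simple_graph_edgeD[OF G] by blast
  have fin: "finite V" using G by (simp add: simple_graph_def)
  have "card ({..<card V} - g ` ?N) = card V - card ?N" if "g \<in> ?O" for g
  proof -
    have g: "g ` V = {..<card V}" using that by (auto simp: onto_colorings_def)
    then have inj: "inj_on g V" using eq_card_imp_inj_on[OF fin, of g] by simp
    have "card ({..<card V} - g ` ?N) = card {..<card V} - card (g ` ?N)"
      using N g finite_subset[OF N fin] by (intro card_Diff_subset) auto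
    then show ?thesis using card_image[OF inj_on_subset[OF inj N]] by simp
  qed
  then have "(\<Sum>g\<in>?O. real (card ({..<card V} - g ` ?N))) = card ?O * real (card V - card ?N)"
    by simp
  then show ?thesis
    using stable_partitions_insert_Suc[OF G v, of j]
    unfolding j[symmetric] by (simp add: stable_partitions_def)
qed

text \<open>In a disjoint union of sets of sizes \<open>a\<close> and \<open>d\<close>, the left
  side counts the subsets of size \<open>Suc i\<close> with at most one element in the second set.
  This closes the induction for the coefficient bound.\<close>

lemma choose_add_mult_le:
  "(a choose Suc i) + d * (a choose i) \<le> (a + d) choose Suc i"
proof (induction d)
  case (Suc d)
  have "a choose i \<le> (a + d) choose i" by (rule binomial_right_mono) simp
  then show ?case using Suc by simp
qed simp

text \<open>The claims are proved together because the value at \<open>card V - 1\<close> depends on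
  the value at \<open>card V\<close> for the smaller graph. The guard \<open>V \<noteq> {}\<close>
  excludes the empty graph, where \<open>card V - 1\<close> is truncated to 0 and the value is
  1.\<close>

lemma stable_partitions_aux:
  assumes "finite V" "simple_graph V E" "card E + e = card V choose 2"
  shows "stable_partitions V E (card V) = 1 \<and>
    (V \<noteq> {} \<longrightarrow> stable_partitions V E (card V - 1) = e) \<and>
    (\<forall>i \<le> card V. stable_partitions V E (card V - i) \<le> real (e choose i))"
  using assms
proof (induction V arbitrary: E e rule: finite_induct)
  case empty
  have "onto_colorings {} E {..<0} = {\<lambda>_. undefined}"
    using empty by (auto simp: onto_colorings_def simple_graph_def)
  then show ?case by (simp add: stable_partitions_def)
next
  case (insert v V)
  let ?E = "{e \<in> E. v \<notin> e}" and ?N = "{u. {u, v} \<in> E}"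
  note G = insert.prems(1) and v = insert.hyps(2)
  note G' = simple_graph_delete_vertex[OF G]
  define e' where "e' = (card V choose 2) - card ?E"
  define d where "d = card V - card ?N"
  have e': "card ?E + e' = card V choose 2"
    using card_edges_le[OF G'] by (simp add: e'_def)
  have "?N \<subseteq> V" using simple_graph_edgeD[OF G] by blast
  then have d: "d + card ?N = card V"
    using card_mono[OF insert.hyps(1)] by (simp add: d_def)
  have "Suc (card V) choose 2 = (card V choose 2) + card V"
    by (simp add: numeral_2_eq_2)
  \<comment> \<open>The non-edges at \<open>v\<close> are counted by \<open>d\<close>, all others by
    \<open>e'\<close>.\<close>
  then have e: "e = e' + d"
    using insert.prems(2) insert.hyps e' d card_edges_delete_vertex[OF G] by simp
  have IH: "stable_partitions V ?E (card V) = 1"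
    "V \<noteq> {} \<Longrightarrow> stable_partitions V ?E (card V - 1) = e'"
    "\<And>i. i \<le> card V \<Longrightarrow> stable_partitions V ?E (card V - i) \<le> real (e' choose i)"
    using insert.IH[OF G' e'] by blast+
  have n: "card (insert v V) = Suc (card V)" using insert.hyps by simp
  \<comment> \<open>There are too few vertices in \<open>V\<close> for this many colours, so only
    the case of \<open>v\<close> as its own block survives.\<close>
  have "onto_colorings V ?E {..<Suc (card V)} = {}"
    using stable_partitions_eq_0_card[OF insert.hyps(1), of "Suc (card V)" ?E]
      finite_onto_colorings[OF insert.hyps(1), of "{..<Suc (card V)}"]
    by (simp add: stable_partitions_def)
  then have one: "stable_partitions (insert v V) E (Suc (card V)) = 1"
    unfolding stable_partitions_insert_Suc[OF G v] IH(1) by simp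
  have two: "stable_partitions (insert v V) E (card V) = e"
  proof (cases "card V")
    case 0
    then show ?thesis
      using insert.prems(2) insert.hyps stable_partitions_insert_0[of v "{}" E]
      by (simp add: numeral_2_eq_2)
  next
    case (Suc j)
    then have "V \<noteq> {}" by auto
    then show ?thesis
      using stable_partitions_insert_card[OF G v Suc] IH Suc by (simp add: e d_def)
  qed
  have three: "stable_partitions (insert v V) E (Suc (card V) - i) \<le> real (e choose i)"
    if i: "i \<le> Suc (card V)" for i
  proof (cases i)
    case 0
    then show ?thesis using one by simp
  next
    case (Suc r)
    show ?thesis
    \<comment> \<open>In this case the index is 0, which the recursion does not reach; a nonempty
      set has no partition into 0 blocks.\<close>
    proof (cases "r = card V")
      case True
      then show ?thesis using Suc stable_partitions_insert_0[of v V E] by simp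
    next
      case False
      then have r: "r < card V" using i Suc by simp
      then have j: "Suc (card V) - i = Suc (card V - Suc r)" using Suc by simp
      have j': "Suc (card V - Suc r) = card V - r" using r by simp
      have "stable_partitions (insert v V) E (Suc (card V) - i) \<le>
          stable_partitions V ?E (card V - Suc r) + real d * stable_partitions V ?E (card V - r)"
        using stable_partitions_insert_Suc_le[OF G v, of "card V - Suc r"]
        unfolding j j' d_def[symmetric] .
      also have "\<dots> \<le> real (e' choose Suc r) + real d * real (e' choose r)"
        using r by (intro add_mono mult_left_mono IH(3)) auto
      also have "\<dots> = real ((e' choose Suc r) + d * (e' choose r))" by simp
      also have "\<dots> \<le> real (e choose i)"
        unfolding e Suc by (rule of_nat_mono[OF choose_add_mult_le])
      finally show ?thesis .
    qed
  qed
  show ?case unfolding n using one two three by simp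
qed

lemma stable_partitions_card:
  assumes "simple_graph V E"
  shows "stable_partitions V E (card V) = 1"
  using stable_partitions_aux[of V E "(card V choose 2) - card E"] assms card_edges_le[OF assms]
  by (simp add: simple_graph_def)

lemma stable_partitions_card_minus_1:
  assumes "simple_graph V E" "card E + e = card V choose 2" "card V > 0"
  shows "stable_partitions V E (card V - 1) = e"
  using stable_partitions_aux[of V E e] assms by (auto simp: simple_graph_def)

lemma stable_partitions_le_choose:
  assumes "simple_graph V E" "card E + e = card V choose 2" "i \<le> card V"
  shows "stable_partitions V E (card V - i) \<le> real (e choose i)"
  using stable_partitions_aux[of V E e] assms by (auto simp: simple_graph_def)

section \<open>The chromatic polynomial in falling factorials\<close>

text \<open>Both sides are polynomials that agree at every natural number: the \<open>fact i\<close>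
  in the denominator of \<open>q choose i\<close> moves into the coefficient.\<close>

lemma poly_chromatic_poly:
  assumes G: "simple_graph V E"
  shows "poly (chromatic_poly V E) z =
    (\<Sum>i\<le>card V. of_real (stable_partitions V E i) * (\<Prod>j<i. z - of_nat j))"
proof -
  define p where
    "p = (\<Sum>i\<le>card V. smult (of_real (stable_partitions V E i)) (\<Prod>j<i. [:- of_nat j, 1 :: complex:]))"
  have p: "poly p z = (\<Sum>i\<le>card V. of_real (stable_partitions V E i) * (\<Prod>j<i. z - of_nat j))" for z
    by (simp add: p_def poly_sum poly_prod)
  have "chromatic_poly V E = p"
  proof (rule poly_eqI_of_nat)
    fix q
    have "(of_nat (q choose i) :: complex) = (\<Prod>j<i. of_nat q - of_nat j) / fact i" for i
      by (simp only: binomial_gbinomial gbinomial_prod_rev atLeast0LessThan)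
    then show "poly (chromatic_poly V E) (of_nat q) = poly p (of_nat q)"
      unfolding poly_chromatic_poly_of_nat[OF G] card_proper_colorings[OF G] p
      by (simp add: stable_partitions_def mult.commute)
  qed
  then show ?thesis by (simp add: p)
qed

section \<open>Estimates in the complex plane\<close>

text \<open>In the application \<open>w\<close> is \<open>z - (n - 2)\<close>, \<open>b / w\<close>
  is the term \<open>t 2\<close> and \<open>T\<close> is the tail. The modulus of
  \<open>b / w\<close> is at most \<open>e / (2 * sqrt 2)\<close>, hence at most
  \<open>5 / 14 * e\<close>, and 5/14 + 1/9 < 1/2.\<close>

lemma disc_estimate:
  fixes w T :: complex and e b :: real
  assumes "w - 1 + of_real e = - (of_real b / w) - T"
    and "0 \<le> b" "b \<le> e\<^sup>2 / 2" "b = 0 \<or> cmod w > sqrt 2 * e" "cmod T \<le> e / 9" "0 \<le> e"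
  shows "cmod (w - 1 + of_real e) \<le> e / 2"
proof -
  have "cmod (of_real b / w) \<le> 5 / 14 * e"
  proof (cases "b = 0")
    case False
    then have w: "cmod w > sqrt 2 * e" using assms(4) by simp
    have "7 / 5 \<le> sqrt 2" by (rule real_le_rsqrt) (simp add: power2_eq_square)
    then have "7 / 5 * e \<le> cmod w" using w assms(6) mult_right_mono[of "7/5" "sqrt 2" e] by simp
    then have "5 / 14 * e * (7 / 5 * e) \<le> 5 / 14 * e * cmod w"
      using assms(6) by (intro mult_left_mono) auto
    then have "b \<le> 5 / 14 * e * cmod w" using assms(3) by (simp add: power2_eq_square)
    moreover have "cmod w > 0" using w assms(6) by (intro le_less_trans[OF _ w]) simp
    ultimately show ?thesis using assms(2) by (simp add: norm_divide field_simps)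
  qed (use assms(6) in simp)
  moreover have "cmod (w - 1 + of_real e) \<le> cmod (of_real b / w) + cmod T"
    unfolding assms(1) using norm_triangle_ineq4[of "- (of_real b / w)" T] by simp
  ultimately show ?thesis using assms(5,6) by simp
qed

text \<open>
  The triangle inequality alone gives the constant \<open>1 + 1 / sqrt 8 + 1 / 9\<close>, which exceeds
  \<open>sqrt 2\<close>. In the left half-plane \<^term>\<open>e + b / w\<close> is smaller because
  \<^term>\<open>b / w\<close> has nonpositive real part; in the right half-plane \<^term>\<open>w - 1 + e\<close> is too far
  from \<^term>\<open>0\<close> for the disc estimate.
\<close>

lemma modulus_estimate:
  fixes w T :: complex and e b :: real
  assumes eq: "w - 1 + of_real e = - (of_real b / w) - T"
    and b: "0 \<le> b" "b \<le> e\<^sup>2 / 2" and T: "cmod T \<le> e / 9"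
    and e: "e = 0 \<or> e \<ge> 1" and w: "b = 0 \<or> cmod w > sqrt 2 * e"
  shows "cmod (w - 1) \<le> sqrt 2 * e"
proof (rule ccontr)
  assume "\<not> ?thesis"
  then have far: "cmod (w - 1) > sqrt 2 * e" by simp
  have e0: "e \<ge> 0" using e by auto
  have s2: "7 / 5 \<le> sqrt 2" by (rule real_le_rsqrt) (simp add: power2_eq_square)
  have cm: "(cmod u)\<^sup>2 = (Re u)\<^sup>2 + (Im u)\<^sup>2" for u :: complex by (simp add: cmod_def)
  show False
  proof (cases "e = 0")
    case True
    then have "w - 1 = 0" using eq b T by simp
    then show False using far True by simp
  next
    case False
    then have e1: "e \<ge> 1" using e by simp
    have sq: "x\<^sup>2 > 2 * e\<^sup>2" if "x > sqrt 2 * e" for x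
      using power_strict_mono[OF that, of 2] e0 by (simp add: power_mult_distrib)
    show False
    proof (cases "Re w > 0")
      case True
      have "cmod (w - 1 + of_real e) \<le> e / 2"
        using disc_estimate[OF eq b w T e0] .
      then have "(cmod (w - 1 + of_real e))\<^sup>2 \<le> (e / 2)\<^sup>2" by (intro power_mono) auto
      \<comment> \<open>The first summand exceeds \<open>2 * e\<^sup>2\<close>, and
        \<open>2 * e\<close> is at most \<open>2 * e\<^sup>2\<close> since \<open>e \<ge> 1\<close>.
        The total thus exceeds \<open>e\<^sup>2\<close>, against the bound
        \<open>e / 2\<close>.\<close>
      moreover have "(cmod (w - 1 + of_real e))\<^sup>2 =
          (cmod (w - 1))\<^sup>2 + 2 * e * Re w - 2 * e + e\<^sup>2"
        unfolding cm by (simp add: power2_eq_square algebra_simps)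
      moreover have "2 * e * Re w \<ge> 0" using True e0 by simp
      moreover have "e \<le> e\<^sup>2" using mult_left_mono[OF e1 e0] by (simp add: power2_eq_square)
      ultimately have "e\<^sup>2 < (e / 2)\<^sup>2" using sq[OF far] by linarith
      then show False by (simp add: power2_eq_square)
    next
      case False
      have "Re (of_real b / w) \<le> 0"
        using False b by (simp add: Re_divide divide_nonpos_nonneg mult_nonneg_nonpos)
      then have "2 * e * Re (of_real b / w) \<le> 0" using e0 by (simp add: mult_nonneg_nonpos)
      moreover have "(cmod (of_real e + of_real b / w))\<^sup>2 =
          e\<^sup>2 + 2 * e * Re (of_real b / w) + (cmod (of_real b / w))\<^sup>2"
        unfolding cm by (simp add: power2_eq_square algebra_simps)
      moreover have "(cmod (of_real b / w))\<^sup>2 \<le> e\<^sup>2 / 8"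
      proof (cases "b = 0")
        case False
        then have w: "cmod w > sqrt 2 * e" using w by simp
        have "b\<^sup>2 \<le> (e\<^sup>2 / 2)\<^sup>2" using b by (intro power_mono) auto
        also have "\<dots> = e\<^sup>2 / 8 * (2 * e\<^sup>2)" by (simp add: power2_eq_square)
        also have "\<dots> \<le> e\<^sup>2 / 8 * (cmod w)\<^sup>2" using sq[OF w] by (intro mult_left_mono) auto
        finally have "b\<^sup>2 \<le> e\<^sup>2 / 8 * (cmod w)\<^sup>2" .
        moreover have "sqrt 2 * e \<ge> 0" using e0 by simp
        then have "w \<noteq> 0" using w by auto
        ultimately show ?thesis by (simp add: norm_divide power_divide field_simps)
      qed simp
      \<comment> \<open>The three summands give at most (1 + 1/8) times \<open>e\<^sup>2\<close>.
        The rounding to 11/10 suffices because 11/10 + 1/9 < 7/5.\<close>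
      moreover have "9 / 8 * e\<^sup>2 \<le> (11 / 10 * e)\<^sup>2" by (simp add: power2_eq_square)
      ultimately have "(cmod (of_real e + of_real b / w))\<^sup>2 \<le> (11 / 10 * e)\<^sup>2" by linarith
      then have "cmod (of_real e + of_real b / w) \<le> 11 / 10 * e"
        by (rule power2_le_imp_le) (use e0 in simp)
      moreover have "w - 1 = - (of_real e + of_real b / w) - T" using eq by (simp add: algebra_simps)
      then have "cmod (w - 1) \<le> cmod (of_real e + of_real b / w) + cmod T"
        using norm_triangle_ineq4[of "- (of_real e + of_real b / w)" T] by (simp only: norm_minus_cancel)
      moreover have "7 / 5 * e \<le> sqrt 2 * e" using s2 e0 by (rule mult_right_mono)
      ultimately show False using T far e1 by linarith
    qed
  qed
qed

section \<open>Geometric bounds for the tail\<close>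

lemma fact_ge_geometric: "6 * 4 ^ l \<le> (fact (Suc (Suc (Suc l))) :: real)"
proof (induction l)
  case (Suc l)
  have "(6 * 4 ^ Suc l :: real) = 4 * (6 * 4 ^ l)" by simp
  also have "\<dots> \<le> real (Suc (Suc (Suc (Suc l)))) * fact (Suc (Suc (Suc l)))"
    using Suc by (intro mult_mono) auto
  finally show ?case by (simp only: fact_Suc[symmetric] of_nat_fact)
qed (simp add: eval_nat_numeral)

text \<open>Here \<open>e choose i\<close> is at most \<open>e ^ i / fact i\<close>, and
  \<open>fact i\<close> is at least \<open>6 * 4 ^ (i - 3)\<close> because every factor beyond 3 is
  at least 4. The remaining factor 2 of 12 comes from \<open>sqrt 2 ^ (i - 1)\<close>.\<close>

lemma choose_div_power_le:
  assumes "i \<ge> 3"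
  shows "real (e choose i) / (sqrt 2 * real e) ^ (i - 1) \<le> real e / 12 * (1 / 4) ^ (i - 3)"
proof (cases "e = 0")
  case False
  obtain l where i: "i = Suc (Suc (Suc l))" using assms by (metis Suc_le_D numeral_3_eq_3 Suc_le_mono)
  have "real (e choose i) * fact i \<le> real e ^ i"
    using binomial_fact_pow[of e i] by (metis of_nat_fact of_nat_le_iff of_nat_mult of_nat_power)
  then have "real (e choose i) * (6 * 4 ^ l) \<le> real e ^ i"
    using mult_left_mono[OF fact_ge_geometric[of l], of "real (e choose i)"] unfolding i by linarith
  then have "real (e choose i) \<le> real e / (6 * 4 ^ l) * real e ^ (i - 1)"
    unfolding i by (simp add: field_simps)
  also have "\<dots> \<le> real e / (12 * 4 ^ l) * (sqrt 2 * real e) ^ (i - 1)"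
  proof -
    have "(sqrt 2)\<^sup>2 * 1 \<le> (sqrt 2)\<^sup>2 * sqrt 2 ^ l"
      by (intro mult_left_mono one_le_power) auto
    then have "2 \<le> sqrt 2 ^ (i - 1)" unfolding i by (simp add: power2_eq_square mult.assoc[symmetric])
    then have "real e / (12 * 4 ^ l) * real e ^ (i - 1) * 2 \<le>
        real e / (12 * 4 ^ l) * real e ^ (i - 1) * sqrt 2 ^ (i - 1)"
      by (intro mult_left_mono) auto
    then show ?thesis by (simp add: power_mult_distrib mult_ac)
  qed
  finally have "real (e choose i) / (sqrt 2 * real e) ^ (i - 1) \<le> real e / (12 * 4 ^ l)"
    using False by (simp add: pos_divide_le_eq)
  then show ?thesis unfolding i by (simp add: power_one_over)
qed (use assms in \<open>simp add: binomial_eq_0\<close>)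

lemma sum_geometric_le: "(\<Sum>i=3..n. (1 / 4 :: real) ^ (i - 3)) \<le> 4 / 3"
proof -
  \<comment> \<open>Subtracting the remainder makes the induction work. For \<open>n \<le> 2\<close>
    both sides are 0, as \<open>n - 2\<close> is then 0.\<close>
  have "(\<Sum>i=3..n. (1 / 4 :: real) ^ (i - 3)) \<le> 4 / 3 - 4 / 3 * (1 / 4) ^ (n - 2)"
  proof (induction n)
    case (Suc n)
    show ?case
    proof (cases "n \<ge> 2")
      case True
      then have "Suc n - 3 = n - 2" "Suc n - 2 = Suc (n - 2)" by auto
      then show ?thesis using Suc True by (simp add: sum.cl_ivl_Suc)
    qed simp
  qed simp
  also have "\<dots> \<le> 4 / 3" by simp
  finally show ?thesis .
qed

section \<open>The equation satisfied by a root\<close>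

text \<open>After division by the falling factorial of degree \<open>n - 1\<close>, the terms
  \<open>t 0\<close> and \<open>t 1\<close> form the left side, \<open>t 2\<close> is the quotient
  with numerator \<open>b\<close>, and \<open>T\<close> collects the rest. The geometric bound gives
  \<open>e / 12 * (4 / 3) = e / 9\<close> for \<open>T\<close>.\<close>

lemma chromatic_root_equation:
  assumes G: "simple_graph V E" and n: "card V = n" and e: "card E + e = n choose 2"
    and root: "poly (chromatic_poly V E) z = 0"
    and z: "z \<notin> of_nat ` {..<n - 1}"
    and far: "\<And>j. chromatic_number V E \<le> j \<Longrightarrow> j < n - 1 \<Longrightarrow> cmod (z - of_nat j) > sqrt 2 * real e"
  obtains b T where "z - (of_nat n - 1) + of_nat e = - (of_real b / (z - (of_nat n - 2))) - T"
    "0 \<le> b" "b \<le> (real e)\<^sup>2 / 2" "b = 0 \<or> cmod (z - (of_nat n - 2)) > sqrt 2 * real e"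
    "cmod T \<le> real e / 9" "n > 0"
proof -
  define P where "P i = (\<Prod>j<i. z - of_nat j)" for i
  define t where "t i = of_real (stable_partitions V E (n - i)) * P (n - i) / P (n - 1)" for i
  \<comment> \<open>For \<open>n < 2\<close> there is no term \<open>t 2\<close>; the value 0
    matches the empty sum and avoids a truncated index.\<close>
  define b where "b = (if n \<ge> 2 then stable_partitions V E (n - 2) else 0)"
  have sum0: "(\<Sum>i\<le>n. of_real (stable_partitions V E i) * P i) = 0"
    using root unfolding poly_chromatic_poly[OF G] n P_def .
  \<comment> \<open>For \<open>n = 0\<close> the polynomial is the constant 1 and has no
    root.\<close>
  have npos: "n > 0"
    using sum0 stable_partitions_card[OF G] n by (cases n) (auto simp: P_def)
  have P0: "P (n - 1) \<noteq> 0" using z by (auto simp: P_def)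
  have "{..n} = {0..n}" by auto
  then have "(\<Sum>i=0..n. of_real (stable_partitions V E (n - i)) * P (n - i)) = 0"
    using sum0 sum.nat_diff_reindex[of "\<lambda>i. of_real (stable_partitions V E i) * P i" "Suc n"]
    by (simp add: lessThan_Suc_atMost)
  then have "(\<Sum>i=0..n. t i) = 0" by (simp add: t_def sum_divide_distrib[symmetric])
  moreover have "t 0 = z - (of_nat n - 1)"
    using npos P0 stable_partitions_card[OF G] n by (cases n) (auto simp: t_def P_def)
  moreover have "t 1 = of_nat e"
    using stable_partitions_card_minus_1[OF G, of e] e n npos P0 by (simp add: t_def)
  ultimately have eq: "z - (of_nat n - 1) + of_nat e + (\<Sum>i=2..n. t i) = 0"
    using npos by (simp add: sum.atLeast_Suc_atMost numeral_2_eq_2 add.assoc)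
  have t_le: "cmod (t i) \<le> real (e choose i) / (sqrt 2 * real e) ^ (i - 1)" if i: "2 \<le> i" "i \<le> n" for i
  proof (cases "stable_partitions V E (n - i) = 0")
    case False
    \<comment> \<open>A nonzero coefficient puts all indices from \<open>n - i\<close> to
      \<open>n - 2\<close> in the range of \<open>far\<close>.\<close>
    then have k: "chromatic_number V E \<le> n - i"
      using stable_partitions_eq_0_chromatic_number by (meson not_le)
    have le: "stable_partitions V E (n - i) \<le> real (e choose i)"
      using stable_partitions_le_choose[OF G, of e i] e n i by simp
    have "e \<noteq> 0"
    proof
      assume "e = 0"
      then have "e choose i = 0" using i by (simp add: binomial_eq_0)
      then have "stable_partitions V E (n - i) \<le> 0" using le by (simp only: of_nat_0)
      then show False using False stable_partitions_nonneg[of V E "n - i"] by linarith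
    qed
    then have R: "sqrt 2 * real e > 0" by simp
    \<comment> \<open>After cancellation \<open>i - 1\<close> linear factors remain in the
      denominator, each of modulus above \<open>sqrt 2 * e\<close>.\<close>
    define Q where "Q = (\<Prod>j=n-i..<n-1. z - of_nat j)"
    have "P (n - 1) = P (n - i) * Q"
      using i unfolding P_def Q_def lessThan_atLeast0
      by (intro prod.atLeastLessThan_concat[symmetric]) auto
    then have t: "t i = of_real (stable_partitions V E (n - i)) / Q" using P0 by (simp add: t_def)
    have "(\<Prod>j=n-i..<n-1. sqrt 2 * real e) \<le> (\<Prod>j=n-i..<n-1. cmod (z - of_nat j))"
      using far k R by (intro prod_mono) (auto intro!: less_imp_le)
    moreover have "n - 1 - (n - i) = i - 1" using i by simp
    ultimately have "(sqrt 2 * real e) ^ (i - 1) \<le> cmod Q"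
      by (simp add: Q_def prod_norm[symmetric])
    then show ?thesis
      unfolding t norm_divide norm_of_real abs_of_nonneg[OF stable_partitions_nonneg]
      using le R by (intro frac_le) auto
  qed (simp add: t_def)
  have split: "(\<Sum>i=2..n. t i) = of_real b / (z - (of_nat n - 2)) + (\<Sum>i=3..n. t i)"
  proof (cases "n \<ge> 2")
    case True
    define m where "m = n - 2"
    then have m: "n = Suc (Suc m)" using True by simp
    have "P (n - 1) = P (n - 2) * (z - (of_nat n - 2))" unfolding m by (simp add: P_def)
    then have "t 2 = of_real b / (z - (of_nat n - 2))"
      using P0 True by (simp add: t_def b_def)
    then show ?thesis using True by (simp add: sum.atLeast_Suc_atMost eval_nat_numeral)
  qed (simp add: b_def)
  show thesis
  proof (rule that[of b "\<Sum>i=3..n. t i"])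
    show "z - (of_nat n - 1) + of_nat e = - (of_real b / (z - (of_nat n - 2))) - (\<Sum>i=3..n. t i)"
      using eq unfolding split by (simp add: algebra_simps eq_neg_iff_add_eq_0)
    show "0 \<le> b" by (simp add: b_def stable_partitions_nonneg)
    show "b \<le> (real e)\<^sup>2 / 2"
    proof (cases "n \<ge> 2")
      case True
      then have "b \<le> real (e choose 2)"
        using stable_partitions_le_choose[OF G, of e 2] e n by (simp add: b_def)
      also have "\<dots> \<le> (real e)\<^sup>2 / 2"
        using binomial_fact_pow[of e 2] of_nat_mono[of "(e choose 2) * fact 2" "e ^ 2", where 'a = real]
        by simp
      finally show ?thesis .
    qed (simp add: b_def)
    show "b = 0 \<or> cmod (z - (of_nat n - 2)) > sqrt 2 * real e"
    proof (cases "b = 0")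
      case False
      then have n2: "n \<ge> 2" and "stable_partitions V E (n - 2) \<noteq> 0"
        by (auto simp: b_def split: if_splits)
      then have "chromatic_number V E \<le> n - 2"
        using stable_partitions_eq_0_chromatic_number by (meson not_le)
      moreover have "n - 2 < n - 1" using n2 by simp
      ultimately have "cmod (z - of_nat (n - 2)) > sqrt 2 * real e" by (rule far)
      then show ?thesis using n2 by (simp add: of_nat_diff)
    qed simp
    have "cmod (\<Sum>i=3..n. t i) \<le> (\<Sum>i=3..n. real e / 12 * (1 / 4) ^ (i - 3))"
    proof (rule sum_norm_le)
      fix i assume "i \<in> {3..n}"
      then show "cmod (t i) \<le> real e / 12 * (1 / 4) ^ (i - 3)"
        using order_trans[OF t_le choose_div_power_le] by simp
    qed
    also have "\<dots> = real e / 12 * (\<Sum>i=3..n. (1 / 4) ^ (i - 3))" by (simp add: sum_distrib_left)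
    also have "\<dots> \<le> real e / 12 * (4 / 3)"
      by (intro mult_left_mono sum_geometric_le) auto
    finally show "cmod (\<Sum>i=3..n. t i) \<le> real e / 9" by simp
    show "n > 0" by (rule npos)
  qed
qed

section \<open>Location and modulus of the roots\<close>

text \<open>A root violating either claim is far enough from the relevant integers for
  \<open>chromatic_root_equation\<close>; then \<open>disc_estimate\<close> or
  \<open>modulus_estimate\<close> gives the contradiction. The range of centres lies in the integers
  so that \<open>n - 2\<close> is not truncated.\<close>

theorem theorem10:
  fixes V :: "'a set" and E :: "'a set set" and k n m :: nat
  assumes "simple_graph V E"
    and "chromatic_number V E = k"
    and "card V = n"
    and "card E = m"
  shows "(\<forall>z :: complex. poly (chromatic_poly V E) z = 0 \<longrightarrow>
            z \<in> of_nat ` {..<k} \<union>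
              (\<Union>c \<in> of_int ` {int k..int n - 2} \<union>
                     {of_nat n - 1 - of_nat (n choose 2) + of_nat m}.
                 cball c (sqrt 2 * (real (n choose 2) - real m)))) \<and>
         (\<forall>z :: complex. poly (chromatic_poly V E) z = 0 \<longrightarrow>
            cmod z \<le> real n - 1 + sqrt 2 * (real (n choose 2) - real m))"
proof -
  note G = assms(1)
  obtain e where e: "m + e = n choose 2"
    using card_edges_le[OF G] assms(3,4) le_Suc_ex by metis
  then have E: "card E + e = n choose 2" using assms(4) by simp
  have re: "real (n choose 2) - real m = real e" unfolding e[symmetric] by simp
  have ce: "of_nat n - 1 - of_nat (n choose 2) + of_nat m = (of_nat n - 1 - of_nat e :: complex)"
    unfolding e[symmetric] by simp
  have "z \<in> of_nat ` {..<k} \<union> (\<Union>c \<in> of_int ` {int k..int n - 2} \<union> {of_nat n - 1 - of_nat e}.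
      cball c (sqrt 2 * real e))"
    if root: "poly (chromatic_poly V E) z = 0" for z
  proof (rule ccontr)
    assume out: "\<not> ?thesis"
    have far: "cmod (z - of_nat j) > sqrt 2 * real e" if "k \<le> j" "j < n - 1" for j
    proof -
      have "int j \<in> {int k..int n - 2}" using that by auto
      then have "of_nat j \<in> (of_int ` {int k..int n - 2} :: complex set)"
        by (metis image_eqI of_int_of_nat_eq)
      then have "z \<notin> cball (of_nat j) (sqrt 2 * real e)" using out by blast
      then show ?thesis by (simp add: dist_norm norm_minus_commute)
    qed
    have "z \<notin> of_nat ` {..<n - 1}"
    proof
      assume "z \<in> of_nat ` {..<n - 1}"
      then obtain j where j: "j < n - 1" "z = of_nat j" by auto
      then have "k \<le> j" using out by (meson UnI1 image_eqI lessThan_iff not_le)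
      then have "sqrt 2 * real e < 0" using far[of j] j by simp
      then show False by (simp add: mult_less_0_iff)
    qed
    then obtain b T where bT:
      "z - (of_nat n - 1) + of_nat e = - (of_real b / (z - (of_nat n - 2))) - T"
      "0 \<le> b" "b \<le> (real e)\<^sup>2 / 2" "b = 0 \<or> cmod (z - (of_nat n - 2)) > sqrt 2 * real e"
      "cmod T \<le> real e / 9"
      using chromatic_root_equation[OF G assms(3) E root] far assms(2) by metis
    have w: "z - (of_nat n - 2) - 1 = z - (of_nat n - 1)" by simp
    have "cmod (z - (of_nat n - 2) - 1 + of_real (real e)) \<le> real e / 2"
      using bT by (intro disc_estimate[of _ _ b T]) (simp_all add: w)
    also have "\<dots> \<le> sqrt 2 * real e"
      using mult_right_mono[of 1 "sqrt 2" "real e"] by simp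
    finally have "z \<in> cball (of_nat n - 1 - of_nat e) (sqrt 2 * real e)"
      by (simp add: dist_norm norm_minus_commute algebra_simps)
    then show False using out by blast
  qed
  moreover have "cmod z \<le> real n - 1 + sqrt 2 * real e"
    if root: "poly (chromatic_poly V E) z = 0" for z
  proof (rule ccontr)
    assume "\<not> ?thesis"
    then have big: "cmod z > real n - 1 + sqrt 2 * real e" by simp
    \<comment> \<open>The case \<open>j = n - 1\<close> is included: it is the one that contradicts
      \<open>modulus_estimate\<close> at the end.\<close>
    have far: "cmod (z - of_nat j) > sqrt 2 * real e" if "j < n" for j
      using norm_triangle_ineq2[of z "of_nat j"] big that by simp
    have "z \<notin> of_nat ` {..<n - 1}"
    proof
      assume "z \<in> of_nat ` {..<n - 1}"
      then obtain j where j: "j < n - 1" "z = of_nat j" by auto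
      then have "j < n" by simp
      then have "sqrt 2 * real e < 0" using far[of j] j(2) by simp
      then show False by (simp add: mult_less_0_iff)
    qed
    moreover have "cmod (z - of_nat j) > sqrt 2 * real e" if "j < n - 1" for j
      using far[of j] that by linarith
    ultimately obtain b T where bT:
      "z - (of_nat n - 1) + of_nat e = - (of_real b / (z - (of_nat n - 2))) - T"
      "0 \<le> b" "b \<le> (real e)\<^sup>2 / 2" "b = 0 \<or> cmod (z - (of_nat n - 2)) > sqrt 2 * real e"
      "cmod T \<le> real e / 9" "n > 0"
      using chromatic_root_equation[OF G assms(3) E root] by metis
    have w: "z - (of_nat n - 2) - 1 = z - (of_nat n - 1)" by simp
    have "cmod (z - (of_nat n - 2) - 1) \<le> sqrt 2 * real e"
      using bT by (intro modulus_estimate[of _ "real e" b T]) (auto simp: w)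
    then show False using far[of "n - 1"] bT(6) unfolding w by (simp add: of_nat_diff)
  qed
  ultimately show ?thesis unfolding re ce by blast
qed

end
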